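(* Let $p\geq 5$ be prime and let $\mathcal{F}$ be a system of linear equations over $\mathbb{F}_p$ in variables $x_1,\dots,x_n$ with no solution in $\{0,1\}^n$. If there exists a Delayer strategy guaranteeing selection of $h$ branching points in the LinTrees$^{(p)}$ Prover–Delayer game on $\mathcal{F}$, then there exists a Delayer strategy guaranteeing selection of $h$ branching points in the tree-like Res(lin$_{\mathbb{F}_p}$) Prover–Delayer game on $\mathcal{F}$.
   Context: For a linear form $f$, $f(\{0,1\}^n)\subseteq\mathbb{F}_p$ is its set of values on Boolean assignments. LinTrees$^{(p)}$ game on $\mathcal{F}$: a position is a set $\mathcal{H}$ of linear equations; it starts with $\mathcal{H}=\mathcal{F}$. In each round Prover chooses a linear form $f$; Delayer either chooses $a\in f(\{0,1\}^n)$ and $f=a$ is added to $\mathcal{H}$, or declares a branching point and chooses $a_1\neq a_2\in f(\{0,1\}^n)$, after which Prover chooses which of $f=a_1$, $f=a_2$ is added. The game ends when $\mathcal{H}$ has no solution in $\mathbb{F}_p^n$. Tree-like Res(lin$_{\mathbb{F}_p}$) game on $\mathcal{F}$: a position is a set $\mathcal{H}_{\neq}$ of linear inequalities $h\neq c$ ($h$ a linear polynomial, $c\in\mathbb{F}_p$); it starts with $\mathcal{H}_{\neq}=\{0\neq a: a\in\mathbb{F}_p, a\neq 0\}$. In each round Prover chooses an inequality $h\neq c\in\mathcal{H}_{\neq}$ and inequalities $f\neq a$, $g\neq b$ with $(f-a)+(g-b)\equiv h-c$; Delayer either chooses one of $f\neq a$, $g\neq b$ to be added to $\mathcal{H}_{\neq}$,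 or declares a branching point, in which case Prover chooses which of them is added. The game ends when $\mathcal{H}_{\neq}$ contains both $x\neq 0$ and $x\neq 1$ for some variable $x$, or contains $f\neq a$ for some equation $f=a$ of $\mathcal{F}$, or contains $0\neq 0$. A Delayer strategy guarantees selection of $h$ branching points if in every play consistent with it (against any Prover) at least $h$ branching points are declared before the game ends. *)

theory Defs
  imports "HOL-Analysis.Analysis" "Berlekamp_Zassenhaus.Finite_Field"
begin

section \<open>Prover--Delayer games\<close>

text \<open>A position is a set of items (equations or inequalities).  In each round Prover makes a query;
  Delayer either selects the item to be added or declares a branching point by offering two items,
  one of which is then added by Prover.\<close>

datatype 'i reply = Select 'i | Branch 'i 'i

fun outcomes :: "'i reply \<Rightarrow> 'i set" where
  "outcomes (Select i) = {i}"
| "outcomes (Branch i j) = {i, j}"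

fun is_branching :: "'i reply \<Rightarrow> bool" where
  "is_branching (Select i) \<longleftrightarrow> False"
| "is_branching (Branch i j) \<longleftrightarrow> True"

record ('q, 'i) game =
  start :: "'i set"
  ended :: "'i set \<Rightarrow> bool"
  queries :: "'i set \<Rightarrow> 'q set"
  replies :: "'q \<Rightarrow> 'i reply set"

text \<open>A history lists the rounds in order: Prover's query, Delayer's reply, the item added.\<close>

type_synonym ('q, 'i) history = "('q \<times> 'i reply \<times> 'i) list"
type_synonym ('q, 'i) strategy = "('q, 'i) history \<Rightarrow> 'q \<Rightarrow> 'i reply"

definition position :: "('q, 'i) game \<Rightarrow> ('q, 'i) history \<Rightarrow> 'i set" where
  "position G hist = start G \<union> {i. \<exists>q r. (q, r, i) \<in> set hist}"

definition branching_points :: "('q, 'i) history \<Rightarrow> nat" where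
  "branching_points hist = length (filter (\<lambda>(q, r, i). is_branching r) hist)"

text \<open>The finite plays, ended or not, in which Delayer follows \<open>\<sigma>\<close> and Prover is arbitrary.\<close>

inductive consistent_play :: "('q, 'i) game \<Rightarrow> ('q, 'i) strategy \<Rightarrow> ('q, 'i) history \<Rightarrow> bool"
  for G \<sigma> where
  empty: "consistent_play G \<sigma> []"
| step: "\<lbrakk>consistent_play G \<sigma> hist; \<not> ended G (position G hist);
    q \<in> queries G (position G hist); i \<in> outcomes (\<sigma> hist q)\<rbrakk>
    \<Longrightarrow> consistent_play G \<sigma> (hist @ [(q, \<sigma> hist q, i)])"

definition delayer_strategy :: "('q, 'i) game \<Rightarrow> ('q, 'i) strategy \<Rightarrow> bool" where
  "delayer_strategy G \<sigma> \<longleftrightarrow>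
    (\<forall>hist q. consistent_play G \<sigma> hist \<and> \<not> ended G (position G hist)
       \<and> q \<in> queries G (position G hist) \<longrightarrow> \<sigma> hist q \<in> replies G q)"

text \<open>Only plays that end are counted: a Prover who stalls forever (for instance by always querying
  the zero form) does not invalidate a guarantee.\<close>

definition guarantees :: "('q, 'i) game \<Rightarrow> ('q, 'i) strategy \<Rightarrow> nat \<Rightarrow> bool" where
  "guarantees G \<sigma> h \<longleftrightarrow>
    (\<forall>hist. consistent_play G \<sigma> hist \<and> ended G (position G hist) \<longrightarrow> h \<le> branching_points hist)"


section \<open>Linear forms, polynomials and equations over a prime field\<close>

text \<open>\<open>'p mod_ring\<close> is the field with \<open>CARD('p)\<close> elements, and the variables are indexed
  by \<open>'n\<close>.  A linear form is given by its coefficient vector.\<close>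

type_synonym ('p, 'n) form = "'p mod_ring ^ 'n"
type_synonym ('p, 'n) equation = "('p, 'n) form \<times> 'p mod_ring"

definition form_value :: "('p::prime_card, 'n::finite) form \<Rightarrow> 'p mod_ring ^ 'n \<Rightarrow> 'p mod_ring" where
  "form_value f x = (\<Sum>i\<in>UNIV. f $ i * x $ i)"

definition boolean_cube :: "('p::prime_card mod_ring ^ 'n::finite) set" where
  "boolean_cube = {x. \<forall>i. x $ i = 0 \<or> x $ i = 1}"

definition solutions :: "('p::prime_card, 'n::finite) equation set \<Rightarrow> ('p mod_ring ^ 'n) set" where
  "solutions E = {x. \<forall>(f, a)\<in>E. form_value f x = a}"

text \<open>A linear polynomial is a pair of a linear form and a constant term, with componentwise
  addition and subtraction; the inequality \<open>h \<noteq> c\<close> is the pair \<open>(h, c)\<close>.\<close>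

type_synonym ('p, 'n) linpoly = "('p, 'n) form \<times> 'p mod_ring"
type_synonym ('p, 'n) ineq = "('p, 'n) linpoly \<times> 'p mod_ring"

definition poly_of_form :: "('p::prime_card, 'n::finite) form \<Rightarrow> ('p, 'n) linpoly" where
  "poly_of_form f = (f, 0)"

definition const_poly :: "'p::prime_card mod_ring \<Rightarrow> ('p, 'n::finite) linpoly" where
  "const_poly c = (0, c)"

definition var :: "'n::finite \<Rightarrow> ('p::prime_card, 'n) linpoly" where
  "var i = (axis i 1, 0)"

fun difference :: "('p::prime_card, 'n::finite) ineq \<Rightarrow> ('p, 'n) linpoly" where
  "difference (h, c) = h - const_poly c"

text \<open>Inequalities that differ only by moving a constant to the other side, such as
  \<open>x + 1 \<noteq> 1\<close> and \<open>x \<noteq> 0\<close>, are identified when deciding whether the game has ended.\<close>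

definition has_ineq :: "('p::prime_card, 'n::finite) ineq set \<Rightarrow> ('p, 'n) ineq \<Rightarrow> bool" where
  "has_ineq H e \<longleftrightarrow> (\<exists>e'\<in>H. difference e' = difference e)"


section \<open>The two games\<close>

definition lintrees_game ::
  "('p::prime_card, 'n::finite) equation set \<Rightarrow> (('p, 'n) form, ('p, 'n) equation) game" where
  "lintrees_game F = \<lparr>
     start = F,
     ended = (\<lambda>H. solutions H = {}),
     queries = (\<lambda>H. UNIV),
     replies = (\<lambda>f. {Select (f, a) | a. a \<in> form_value f ` boolean_cube}
       \<union> {Branch (f, a\<^sub>1) (f, a\<^sub>2) | a\<^sub>1 a\<^sub>2.
            a\<^sub>1 \<in> form_value f ` boolean_cube \<and> a\<^sub>2 \<in> form_value f ` boolean_cube \<and> a\<^sub>1 \<noteq> a\<^sub>2}) \<rparr>"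

text \<open>A query \<open>(e, e\<^sub>1, e\<^sub>2)\<close> consists of the chosen \<open>h \<noteq> c\<close> and its decomposition
  into \<open>f \<noteq> a\<close> and \<open>g \<noteq> b\<close>.\<close>

definition reslin_game ::
  "('p::prime_card, 'n::finite) equation set
     \<Rightarrow> (('p, 'n) ineq \<times> ('p, 'n) ineq \<times> ('p, 'n) ineq, ('p, 'n) ineq) game" where
  "reslin_game F = \<lparr>
     start = {(0, a) | a. a \<noteq> 0},
     ended = (\<lambda>H. (\<exists>i. has_ineq H (var i, 0) \<and> has_ineq H (var i, 1))
       \<or> (\<exists>(f, a)\<in>F. has_ineq H (poly_of_form f, a))
       \<or> has_ineq H (0, 0)),
     queries = (\<lambda>H. {(e, e\<^sub>1, e\<^sub>2). e \<in> H \<and> difference e\<^sub>1 + difference e\<^sub>2 = difference e}),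
     replies = (\<lambda>(e, e\<^sub>1, e\<^sub>2). {Select e\<^sub>1, Select e\<^sub>2, Branch e\<^sub>1 e\<^sub>2}) \<rparr>"

end

theory Submission
  imports Defs
begin

text \<open>Delayer simulates a LinTrees play with position \<open>H\<close> on the side, keeping every inequality
  \<open>h \<noteq> c\<close> such that \<open>h - c\<close> is a nonzero constant on the solutions of \<open>H\<close>.
  If \<open>u + v\<close> is a nonzero constant \<open>d\<close> there, then fixing \<open>u\<close> also fixes \<open>v\<close>, and of two distinct
  values of \<open>u\<close> one always makes \<open>u\<close> nonzero and the other one makes \<open>v\<close> nonzero, so branching points
  can be copied.  The simulation could only end too early when \<open>H\<close> forces some variable
  out of \<open>{0, 1}\<close>, but then a single further LinTrees query ends that play, so at most one
  branching point was still owed.  Hence the simulation is safe while at least two points are owed.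
  The last two are obtained differently: with two owed, Delayer branches as soon as \<open>u\<close>
  is not constant on the solutions of \<open>H\<close>; neither outcome ends the game, and Delayer
  branches again in the very next round.\<close>

section \<open>Strategies from invariants\<close>

lemma position_Nil [simp]: "position G [] = start G"
  by (simp add: position_def)

lemma position_snoc [simp]: "position G (hist @ [(q, r, i)]) = insert i (position G hist)"
  by (auto simp: position_def)

lemma branching_points_Nil [simp]: "branching_points [] = 0"
  by (simp add: branching_points_def)

lemma branching_points_snoc [simp]:
  "branching_points (hist @ [(q, r, i)]) = branching_points hist + (if is_branching r then 1 else 0)"
  by (simp add: branching_points_def)

text \<open>\<open>I k H\<close> is to be read as: Delayer still owes \<open>k\<close> branching points in position \<open>H\<close>.\<close>

lemma strategy_from_invariant:
  assumes init: "I h (start G)"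
    and fin: "\<And>k H. I k H \<Longrightarrow> ended G H \<Longrightarrow> k = 0"
    and step: "\<And>k H q. I k H \<Longrightarrow> \<not> ended G H \<Longrightarrow> q \<in> queries G H \<Longrightarrow>
      \<exists>r\<in>replies G q. \<forall>i\<in>outcomes r. I (k - (if is_branching r then 1 else 0)) (insert i H)"
  shows "\<exists>\<tau>. delayer_strategy G \<tau> \<and> guarantees G \<tau> h"
proof -
  define good where "good k H q r \<longleftrightarrow> r \<in> replies G q \<and>
      (\<forall>i\<in>outcomes r. I (k - (if is_branching r then 1 else 0)) (insert i H))" for k H q r
  \<comment> \<open>The debt is read off the history. Subtraction truncates, so debt 0 at the end
    means exactly that at least \<open>h\<close> branching points occurred.\<close>
  define \<tau> where "\<tau> hist q = (SOME r. good (h - branching_points hist) (position G hist) q r)" for hist q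
  have good: "good (h - branching_points hist) (position G hist) q (\<tau> hist q)"
    if "I (h - branching_points hist) (position G hist)" "\<not> ended G (position G hist)"
      "q \<in> queries G (position G hist)" for hist q
    unfolding \<tau>_def by (rule someI_ex) (use step[OF that] in \<open>auto simp: good_def\<close>)
  have inv: "I (h - branching_points hist) (position G hist)" if "consistent_play G \<tau> hist" for hist
    using that
  proof induction
    case empty
    then show ?case using init by simp
  next
    case (step hist q i)
    then show ?case using good[of hist q] by (auto simp: good_def split: if_splits)
  qed
  have "delayer_strategy G \<tau>"
    unfolding delayer_strategy_def using good inv by (auto simp: good_def)
  moreover have "guarantees G \<tau> h"
    unfolding guarantees_def using fin inv by force
  ultimately show ?thesis by blast
qed


section \<open>Values of linear polynomials\<close>

definition poly_value :: "('p::prime_card, 'n::finite) linpoly \<Rightarrow> 'p mod_ring ^ 'n \<Rightarrow> 'p mod_ring" where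
  "poly_value g x = form_value (fst g) x + snd g"

abbreviation ineq_value :: "('p::prime_card, 'n::finite) ineq \<Rightarrow> 'p mod_ring ^ 'n \<Rightarrow> 'p mod_ring" where
  "ineq_value e x \<equiv> poly_value (difference e) x"

lemma poly_value_add: "poly_value (f + g) x = poly_value f x + poly_value g x"
  by (simp add: poly_value_def form_value_def distrib_right sum.distrib)

lemma form_value_line: "form_value f (x + t *s (y - z)) = form_value f x + t * (form_value f y - form_value f z)"
  by (simp add: form_value_def algebra_simps sum.distrib sum_subtractf sum_distrib_left)

lemma form_value_axis [simp]: "form_value (axis i 1) x = x $ i"
  by (simp add: form_value_def axis_def if_distrib[of "\<lambda>c. c * _"] cong: if_cong)

lemma form_value_0 [simp]: "form_value 0 x = 0"
  by (simp add: form_value_def)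

lemma poly_value_0 [simp]: "poly_value 0 x = 0"
  by (simp add: poly_value_def)

lemma poly_value_var [simp]: "poly_value (var i) x = x $ i"
  by (simp add: poly_value_def var_def)

lemma poly_value_form [simp]: "poly_value (poly_of_form f) x = form_value f x"
  by (simp add: poly_value_def poly_of_form_def)

lemma ineq_value_Pair [simp]: "ineq_value (g, c) x = poly_value g x - c"
  by (simp add: poly_value_def const_poly_def)

declare difference.simps [simp del]

lemma solutions_insert: "solutions (insert (f, a) H) = {x \<in> solutions H. form_value f x = a}"
  by (auto simp: solutions_def)

lemma solutions_line:
  assumes "x \<in> solutions H" "y \<in> solutions H" "z \<in> solutions H"
  shows "x + t *s (y - z) \<in> solutions H"
proof -
  have "form_value f (x + t *s (y - z)) = a" if "(f, a) \<in> H" for f a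
  proof -
    have "form_value f x = a" "form_value f y = a" "form_value f z = a"
      using assms that by (auto simp: solutions_def)
    then show ?thesis unfolding form_value_line by simp
  qed
  then show ?thesis by (auto simp: solutions_def)
qed

text \<open>Suppose \<open>u\<close> is zero at every such point. Then \<open>q\<close> has a
  non-Boolean coordinate \<open>i\<close>, which therefore varies along the line through
  \<open>q\<close> and \<open>w\<close> and takes the values 0 and 1 there. Being affine,
  \<open>u\<close> vanishes on the whole line once it vanishes at these two points, hence also at
  \<open>q\<close>.\<close>

lemma boolean_coordinate_with_nonzero_value:
  assumes w: "w \<in> solutions H" "w $ i \<in> {0, 1}" and q: "q \<in> solutions H" "poly_value u q \<noteq> 0"
  shows "\<exists>x\<in>solutions H. x $ i \<in> {0, 1} \<and> poly_value u x \<noteq> 0"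
proof (rule ccontr)
  assume "\<not> ?thesis"
  then have zero: "poly_value u x = 0" if "x \<in> solutions H" "x $ i \<in> {0, 1}" for x
    using that by blast
  have ne: "w $ i - q $ i \<noteq> 0" using zero[of q] w(2) q by auto
  \<comment> \<open>\<open>s b\<close> is the point of that line whose coordinate \<open>i\<close>
    equals \<open>b\<close>; \<open>\<delta>\<close> below is the slope of \<open>u\<close> with
    respect to this coordinate.\<close>
  define s where "s b = q + ((b - q $ i) / (w $ i - q $ i)) *s (w - q)" for b
  have s_i: "s b $ i = b" for b
  proof -
    have "s b $ i = q $ i + (b - q $ i) / (w $ i - q $ i) * (w $ i - q $ i)"
      by (simp only: s_def vector_add_component vector_smult_component vector_minus_component)
    then show ?thesis using ne by simp
  qed
  have s_sol: "s b \<in> solutions H" for b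
    unfolding s_def using q w by (intro solutions_line)
  define \<delta> where "\<delta> = (form_value (fst u) w - form_value (fst u) q) / (w $ i - q $ i)"
  have val: "poly_value u (s b) = poly_value u q + (b - q $ i) * \<delta>" for b
    unfolding s_def \<delta>_def poly_value_def form_value_line by simp
  have 0: "poly_value u q + (0 - q $ i) * \<delta> = 0" and 1: "poly_value u q + (1 - q $ i) * \<delta> = 0"
    using zero[OF s_sol[of 0]] zero[OF s_sol[of 1]] s_i by (auto simp: val)
  from 1 have "poly_value u q + (0 - q $ i) * \<delta> + \<delta> = 0" by (simp add: algebra_simps)
  with 0 have "\<delta> = 0" by simp
  with 0 q show False by simp
qed


section \<open>The simulation\<close>

text \<open>A solution of \<open>F\<close> in \<open>A\<close> rules out the endings by an equation
  of \<open>F\<close> and by \<open>0 \<noteq> 0\<close>. The Boolean coordinate may be witnessed by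
  a different point for each \<open>i\<close>, so no point of the cube has to satisfy
  \<open>P\<close>.\<close>

lemma reslin_not_ended:
  assumes nz: "\<And>e x. e \<in> P \<Longrightarrow> x \<in> A \<Longrightarrow> ineq_value e x \<noteq> 0"
    and F: "A \<inter> solutions F \<noteq> {}"
    and bool: "\<And>i. \<exists>x\<in>A. x $ i \<in> {0, 1}"
  shows "\<not> ended (reslin_game F) P"
proof -
  have has: "ineq_value e x \<noteq> 0" if "has_ineq P e" "x \<in> A" for e x
    using that nz by (metis has_ineq_def)
  obtain y where y: "y \<in> A" "y \<in> solutions F" using F by blast
  have "\<not> (has_ineq P (var i, 0) \<and> has_ineq P (var i, 1))" for i
  proof
    assume "has_ineq P (var i, 0) \<and> has_ineq P (var i, 1)"
    moreover obtain x where "x \<in> A" "x $ i \<in> {0, 1}" using bool by blast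
    ultimately show False using has[of "(var i, 0)" x] has[of "(var i, 1)" x] by auto
  qed
  moreover have "\<not> has_ineq P (poly_of_form f, a)" if "(f, a) \<in> F" for f a
    using has[OF _ y(1)] y(2) that by (fastforce simp: solutions_def)
  moreover have "\<not> has_ineq P (0, 0)"
    using has[OF _ y(1)] by fastforce
  ultimately show ?thesis by (auto simp: reslin_game_def)
qed

text \<open>A nonconstant affine function on an affine subspace takes every value, so this amounts
  to: all solutions of \<open>H\<close> satisfy the inequality.\<close>

definition nonzero_constant :: "('p::prime_card, 'n::finite) equation set \<Rightarrow> ('p, 'n) ineq \<Rightarrow> bool" where
  "nonzero_constant H e \<longleftrightarrow> (\<exists>d. d \<noteq> 0 \<and> (\<forall>x\<in>solutions H. ineq_value e x = d))"

lemma nonzero_constant_mono: "nonzero_constant H e \<Longrightarrow> solutions H' \<subseteq> solutions H \<Longrightarrow> nonzero_constant H' e"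
  unfolding nonzero_constant_def by blast

lemma start_nonzero_constant: "e \<in> start (reslin_game F) \<Longrightarrow> nonzero_constant H e"
  by (auto simp: reslin_game_def nonzero_constant_def intro!: exI[of _ "- snd e"])

lemma solutions_position_subset: "solutions (position (lintrees_game F) hist) \<subseteq> solutions F"
  by (fastforce simp: position_def lintrees_game_def solutions_def)

locale lintrees_delayer =
  fixes F :: "('p::prime_card, 'n::finite) equation set" and \<sigma> h
  assumes strat: "delayer_strategy (lintrees_game F) \<sigma>"
    and guar: "guarantees (lintrees_game F) \<sigma> h"
begin

abbreviation pos where "pos hist \<equiv> position (lintrees_game F) hist"
abbreviation play where "play hist \<equiv> consistent_play (lintrees_game F) \<sigma> hist"

lemma solvable:
  assumes "play hist" "branching_points hist < h"
  shows "solutions (pos hist) \<noteq> {}"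
  using assms guar by (force simp: guarantees_def lintrees_game_def)

lemma play_snoc:
  assumes "play hist" "branching_points hist < h" "i \<in> outcomes (\<sigma> hist f)"
  shows "play (hist @ [(f, \<sigma> hist f, i)])"
  using assms solvable[OF assms(1,2)] by (intro consistent_play.step) (simp_all add: lintrees_game_def)

lemma reply_cases:
  assumes "play hist" "branching_points hist < h"
  obtains (select) a where "\<sigma> hist f = Select (f, a)" "a \<in> form_value f ` boolean_cube"
  | (branch) a\<^sub>1 a\<^sub>2 where "\<sigma> hist f = Branch (f, a\<^sub>1) (f, a\<^sub>2)" "a\<^sub>1 \<noteq> a\<^sub>2"
      "a\<^sub>1 \<in> form_value f ` boolean_cube" "a\<^sub>2 \<in> form_value f ` boolean_cube"
proof -
  have "\<sigma> hist f \<in> replies (lintrees_game F) f"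
    using strat assms solvable[OF assms] by (simp add: delayer_strategy_def lintrees_game_def)
  then show thesis using that by (auto simp: lintrees_game_def)
qed

text \<open>Otherwise the query of \<open>x\<^sub>i\<close> ends the play at the cost of at most one branching point.\<close>

lemma boolean_coordinate:
  assumes "play hist" "branching_points hist + 2 \<le> h"
  shows "\<exists>x\<in>solutions (pos hist). x $ i \<in> {0, 1}"
proof -
  let ?f = "axis i 1 :: ('p, 'n) form"
  have lt: "branching_points hist < h" using assms by simp
  obtain b where b: "(?f, b) \<in> outcomes (\<sigma> hist ?f)" "b \<in> form_value ?f ` boolean_cube"
    by (rule reply_cases[OF assms(1) lt, of ?f]) auto
  let ?hist = "hist @ [(?f, \<sigma> hist ?f, (?f, b))]"
  have "branching_points ?hist < h" using assms(2) by simp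
  with play_snoc[OF assms(1) lt b(1)] have "solutions (pos ?hist) \<noteq> {}" by (rule solvable)
  \<comment> \<open>Legal answers are values of the queried form on the cube, which for a single
    variable are just 0 and 1.\<close>
  moreover have "b \<in> {0, 1}" using b(2) by (auto simp: boolean_cube_def)
  ultimately show ?thesis by (auto simp: solutions_insert)
qed

text \<open>The LinTrees play is only asserted to exist, so the strategy need not record it; the
  bound says that it still has at least \<open>k\<close> branching points to come.\<close>

definition simulated :: "nat \<Rightarrow> ('p, 'n) ineq set \<Rightarrow> bool" where
  "simulated k P \<longleftrightarrow>
     (\<exists>hist. play hist \<and> branching_points hist + k \<le> h \<and> (\<forall>e\<in>P. nonzero_constant (pos hist) e))"

lemma simulated_not_ended:
  assumes "simulated k P" "k \<ge> 2"
  shows "\<not> ended (reslin_game F) P"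
proof -
  obtain hist where hist: "play hist" "branching_points hist + k \<le> h"
    "\<forall>e\<in>P. nonzero_constant (pos hist) e"
    using assms(1) by (auto simp: simulated_def)
  show ?thesis
  proof (rule reslin_not_ended[where A = "solutions (pos hist)"])
    show "solutions (pos hist) \<inter> solutions F \<noteq> {}"
      using solvable[OF hist(1)] hist(2) assms(2) solutions_position_subset[of F hist] by auto
    show "\<exists>x\<in>solutions (pos hist). x $ i \<in> {0, 1}" for i
      using hist(2) assms(2) by (intro boolean_coordinate[OF hist(1)]) simp
  qed (use hist(3) in \<open>auto simp: nonzero_constant_def\<close>)
qed

lemma simulated_step:
  assumes sim: "simulated k P" and k: "k > 0" and e: "e \<in> P"
    and sum: "difference u + difference v = difference e"
  shows "\<exists>r\<in>{Select u, Select v, Branch u v}.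
    \<forall>i\<in>outcomes r. simulated (k - (if is_branching r then 1 else 0)) (insert i P)"
proof -
  obtain hist where hist: "play hist" "branching_points hist + k \<le> h"
    "\<forall>e\<in>P. nonzero_constant (pos hist) e"
    using sim by (auto simp: simulated_def)
  have lt: "branching_points hist < h" using hist(2) k by simp
  obtain d where d: "d \<noteq> 0" "\<And>x. x \<in> solutions (pos hist) \<Longrightarrow> ineq_value u x + ineq_value v x = d"
    using hist(3) e by (auto simp: nonzero_constant_def poly_value_add simp flip: sum)
  \<comment> \<open>LinTrees queries are forms without constant term, so the constant of
    \<open>u\<close> is split off.\<close>
  define f where "f = fst (difference u)"
  define c where "c = snd (difference u)"
  let ?r = "\<sigma> hist f"
  let ?k = "k - (if is_branching ?r then 1 else 0)"
  have sim': "simulated ?k (insert w P)"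
    if a: "(f, a) \<in> outcomes ?r" and w: "nonzero_constant (pos (hist @ [(f, ?r, (f, a))])) w" for a w
  proof -
    let ?hist = "hist @ [(f, ?r, (f, a))]"
    have "play ?hist" using play_snoc hist(1) lt a .
    \<comment> \<open>Here \<open>k > 0\<close> keeps the subtraction in \<open>?k\<close> from
      truncating.\<close>
    moreover have "branching_points ?hist + ?k \<le> h" using hist(2) k by simp
    moreover have "nonzero_constant (pos ?hist) e" if "e \<in> P" for e
      using that hist(3) by (auto intro: nonzero_constant_mono simp: solutions_insert)
    ultimately show ?thesis using w unfolding simulated_def by blast
  qed
  have sim_u: "simulated ?k (insert u P)" if "(f, a) \<in> outcomes ?r" "a + c \<noteq> 0" for a
    using that by (intro sim')
      (auto simp: nonzero_constant_def poly_value_def solutions_insert f_def c_def)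
  have sim_v: "simulated ?k (insert v P)" if "(f, a) \<in> outcomes ?r" "a + c \<noteq> d" for a
  proof (rule sim'[OF that(1)])
    have "ineq_value v x = d - (a + c)" if "x \<in> solutions (pos hist)" "form_value f x = a" for x
      using d(2)[OF that(1)] that(2) by (auto simp: poly_value_def f_def c_def algebra_simps)
    then show "nonzero_constant (pos (hist @ [(f, ?r, (f, a))])) v"
      using \<open>a + c \<noteq> d\<close> by (auto simp: nonzero_constant_def solutions_insert intro!: exI[of _ "d - (a + c)"])
  qed
  show ?thesis
  proof (rule reply_cases[OF hist(1) lt, of f])
    fix a assume r: "?r = Select (f, a)"
    show ?thesis
    proof (cases "a + c = 0")
      case True
      then have "simulated ?k (insert v P)" using d(1) r by (intro sim_v[of a]) auto
      then show ?thesis using r by auto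
    next
      case False
      then have "simulated ?k (insert u P)" using r by (intro sim_u[of a]) auto
      then show ?thesis using r by auto
    qed
  next
    fix a\<^sub>1 a\<^sub>2 assume r: "?r = Branch (f, a\<^sub>1) (f, a\<^sub>2)" and ne: "a\<^sub>1 \<noteq> a\<^sub>2"
    \<comment> \<open>The LinTrees outcome is picked only after Prover has chosen \<open>u\<close>
      or \<open>v\<close>. At most one of the two values makes \<open>u\<close> zero, and at most
      one makes \<open>v\<close> zero.\<close>
    have "a\<^sub>1 + c \<noteq> 0 \<or> a\<^sub>2 + c \<noteq> 0" "a\<^sub>1 + c \<noteq> d \<or> a\<^sub>2 + c \<noteq> d"
      using ne by (metis add_right_cancel)+
    then have "simulated ?k (insert u P)" "simulated ?k (insert v P)"
      using r sim_u[of a\<^sub>1] sim_u[of a\<^sub>2] sim_v[of a\<^sub>1] sim_v[of a\<^sub>2] by auto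
    then show ?thesis using r by auto
  qed
qed

text \<open>No LinTrees round is added to the simulated play. If one of \<open>u\<close>,
  \<open>v\<close> vanishes on all its solutions, the other is the constant \<open>d\<close> there;
  otherwise each is nonzero somewhere, and adding either one leaves the game open.\<close>

lemma simulated_step_two:
  assumes sim: "simulated 2 P" and e: "e \<in> P"
    and sum: "difference u + difference v = difference e"
  shows "simulated 2 (insert u P) \<or> simulated 2 (insert v P) \<or>
    \<not> ended (reslin_game F) (insert u P) \<and> \<not> ended (reslin_game F) (insert v P)"
proof -
  obtain hist where hist: "play hist" "branching_points hist + 2 \<le> h"
    "\<forall>e\<in>P. nonzero_constant (pos hist) e"
    using sim by (auto simp: simulated_def)
  obtain d where d: "d \<noteq> 0" "\<And>x. x \<in> solutions (pos hist) \<Longrightarrow> ineq_value u x + ineq_value v x = d"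
    using hist(3) e by (auto simp: nonzero_constant_def poly_value_add simp flip: sum)
  have not_ended: "\<not> ended (reslin_game F) (insert w P)"
    if q: "q \<in> solutions (pos hist)" "ineq_value w q \<noteq> 0" for w q
  \<comment> \<open>This set need not be affine; its points with a Boolean coordinate come from the
    line argument.\<close>
  proof (rule reslin_not_ended[where A = "{x \<in> solutions (pos hist). ineq_value w x \<noteq> 0}"])
    show "{x \<in> solutions (pos hist). ineq_value w x \<noteq> 0} \<inter> solutions F \<noteq> {}"
      using q solutions_position_subset[of F hist] by auto
    show "\<exists>x\<in>{x \<in> solutions (pos hist). ineq_value w x \<noteq> 0}. x $ i \<in> {0, 1}" for i
      using boolean_coordinate[OF hist(1,2), of i] boolean_coordinate_with_nonzero_value[OF _ _ q]
      by blast
  qed (use hist(3) in \<open>auto simp: nonzero_constant_def\<close>)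
  have *: "simulated 2 (insert w P)" if "nonzero_constant (pos hist) w" for w
    using hist that by (auto simp: simulated_def)
  consider "nonzero_constant (pos hist) u" | "nonzero_constant (pos hist) v"
    | p q where "p \<in> solutions (pos hist)" "ineq_value u p \<noteq> 0"
        "q \<in> solutions (pos hist)" "ineq_value v q \<noteq> 0"
  proof (cases "\<exists>p\<in>solutions (pos hist). ineq_value u p \<noteq> 0")
    case False
    then have "nonzero_constant (pos hist) v"
      using d by (auto simp: nonzero_constant_def)
    then show thesis using that by blast
  next
    case True
    then obtain p where p: "p \<in> solutions (pos hist)" "ineq_value u p \<noteq> 0" by blast
    show thesis
    proof (cases "\<exists>q\<in>solutions (pos hist). ineq_value v q \<noteq> 0")
      case False
      then have "nonzero_constant (pos hist) u"
        using d by (auto simp: nonzero_constant_def)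
      then show thesis using that by blast
    qed (use p that in blast)
  qed
  then show ?thesis
    by cases (use * not_ended in blast)+
qed

text \<open>With one point owed an open game suffices, since Delayer branches in the next round;
  with none owed nothing is required.\<close>

definition owes :: "nat \<Rightarrow> ('p, 'n) ineq set \<Rightarrow> bool" where
  "owes k P \<longleftrightarrow> (if k \<ge> 2 then simulated k P else k = 1 \<longrightarrow> \<not> ended (reslin_game F) P)"

lemma owes_start: "owes h (start (reslin_game F))"
proof (cases "h \<ge> 2")
  case True
  then show ?thesis
    using consistent_play.empty start_nonzero_constant
    by (fastforce simp: owes_def simulated_def intro: exI[of _ "[]"])
next
  case False
  have "\<not> ended (reslin_game F) (start (reslin_game F))" if "h = 1"
  \<comment> \<open>The initial inequalities hold everywhere, and the guarantee of one branching
    point makes \<open>F\<close> itself solvable over the field.\<close>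
  proof (rule reslin_not_ended[where A = UNIV])
    show "UNIV \<inter> solutions F \<noteq> {}"
      using solvable[OF consistent_play.empty] that solutions_position_subset[of F "[]"] by auto
    show "\<exists>x::'p mod_ring ^ 'n\<in>UNIV. x $ i \<in> {0, 1}" for i
      by (intro bexI[of _ 0]) auto
  qed (auto simp: reslin_game_def)
  with False show ?thesis by (auto simp: owes_def)
qed

lemma owes_step:
  assumes "owes k P" "e \<in> P" "difference u + difference v = difference e"
  shows "\<exists>r\<in>{Select u, Select v, Branch u v}.
    \<forall>i\<in>outcomes r. owes (k - (if is_branching r then 1 else 0)) (insert i P)"
proof -
  consider "k \<le> 1" | "k = 2" | "k \<ge> 3" by linarith
  then show ?thesis
  proof cases
    case 1
    then show ?thesis by (intro bexI[of _ "Branch u v"]) (auto simp: owes_def)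
  next
    case 2
    then show ?thesis using assms simulated_step_two[of P e u v] by (auto simp: owes_def)
  next
    case 3
    then have "simulated k P" using assms(1) by (simp add: owes_def)
    then obtain r where
      "r \<in> {Select u, Select v, Branch u v}"
      "\<forall>i\<in>outcomes r. simulated (k - (if is_branching r then 1 else 0)) (insert i P)"
      using simulated_step[of k P e u v] assms(2,3) 3 by (metis gr0I not_numeral_le_zero)
    \<comment> \<open>From three owed points, one branching leaves at least two, so the simulated
      case of \<open>owes\<close> still applies.\<close>
    moreover have "k - (if is_branching r then 1 else 0) \<ge> 2" using 3 by auto
    ultimately show ?thesis unfolding owes_def by metis
  qed
qed

end

theorem theorem3p8:
  fixes F :: "('p::prime_card, 'n::finite) equation set" and h :: nat
  assumes "CARD('p) \<ge> 5"
    and "solutions F \<inter> boolean_cube = {}"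
    and "\<exists>\<sigma>. delayer_strategy (lintrees_game F) \<sigma> \<and> guarantees (lintrees_game F) \<sigma> h"
  shows "\<exists>\<tau>. delayer_strategy (reslin_game F) \<tau> \<and> guarantees (reslin_game F) \<tau> h"
proof -
  obtain \<sigma> where "delayer_strategy (lintrees_game F) \<sigma>" "guarantees (lintrees_game F) \<sigma> h"
    using assms(3) by blast
  then interpret lintrees_delayer F \<sigma> h by unfold_locales
  show ?thesis
  proof (rule strategy_from_invariant[of owes])
    show "owes h (start (reslin_game F))" by (rule owes_start)
    show "k = 0" if "owes k P" "ended (reslin_game F) P" for k P
      using that simulated_not_ended[of k P] by (auto simp: owes_def split: if_splits)
    show "\<exists>r\<in>replies (reslin_game F) q.
        \<forall>i\<in>outcomes r. owes (k - (if is_branching r then 1 else 0)) (insert i P)"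
      if "owes k P" "q \<in> queries (reslin_game F) P" for k P q
    proof -
      obtain e u v where "q = (e, u, v)" "e \<in> P" "difference u + difference v = difference e"
        using \<open>q \<in> queries (reslin_game F) P\<close> by (auto simp: reslin_game_def)
      then show ?thesis using owes_step[OF \<open>owes k P\<close>] by (simp add: reslin_game_def)
    qed
  qed
qed

end
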